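(* Let $f:(\mathbb{R}^2,0)\to(\mathbb{R}^3,0)$ be a frontal with unit normal $\nu$, let $0$ be a singular point of the second kind of $f$, and let $\{\boldsymbol e,\boldsymbol b,\boldsymbol\nu\}$ be the Darboux frame along the singular curve of $f$, defined on a small open interval $I\ni0$, with invariants $\tilde\kappa_g,\tilde\kappa_\nu,\tilde\kappa_t$. (A) Suppose that $\tilde\kappa_t^2+\tilde\kappa_\nu^2\neq0$ on $I$. Then the following are equivalent: (1) $OD_f$ is a cylinder; (2) $\tilde\delta_o\equiv0$; (3) $\boldsymbol\nu$ is a part of a great circle in $S^2$; (4) $S(f)$ is a tangential contour edge with respect to an orthogonal projection; (5) $\overline{D_o}$ is a constant vector. (B) Suppose that $\tilde\kappa_g^2+\tilde\kappa_t^2\neq0$ on $I$. Then the following are equivalent: (1) $ND_f$ is a cylinder; (2) $\tilde\delta_n\equiv0$; (3) $\boldsymbol b$ is a part of a great circle in $S^2$; (4) $S(f)$ is a normal contour edge with respect to an orthogonal projection; (5) $\overline{D_n}$ is a constant vector.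
   Context: All maps are $C^\infty$. A map-germ $f:(\mathbb{R}^2,0)\to(\mathbb{R}^3,0)$ is a frontal if there is a unit vector field $\nu:(\mathbb{R}^2,0)\to S^2$ along $f$ (a unit normal) with $\langle df(X),\nu\rangle=0$ for every tangent vector $X$. $S(f)$ is the set of singular points (points where $f$ is not an immersion). Put $\lambda=\det(f_u,f_v,\nu)$. A singular point $p$ is non-degenerate if $d\lambda(p)\neq0$; then $S(f)$ is a regular curve near $p$, parameterized by $\gamma$, and there is a non-vanishing vector field $\eta$ along $\gamma$ with $\ker df_{\gamma(t)}=\mathbb{R}\,\eta(t)$. With $\phi(t)=\det(\gamma'(t),\eta(t))$, a non-degenerate singular point $0=\gamma(0)$ is of the second kind if $\phi(0)=0$, $\phi'(0)\neq0$. In that case $\hat\gamma=f\circ\gamma$ satisfies $\hat\gamma'(0)=0$ and $\det(\hat\gamma''(0),\hat\gamma'''(0),\nu(0))\ne0$. Coordinates $(u,v)$ are taken with $S(f)=\{v=0\}$, $\gamma(u)=(u,0)$, $\hat\gamma(u)=f(u,0)$ ($u\in I$), and oriented so that $\det(\hat\gamma''(0),\hat\gamma'''(0),\nu(0))>0$; $'=d/du$. Darboux frame: $\boldsymbol e(u)$ is the smooth unit vector field along $\gamma$ that is tangent to $\hat\gamma$ for $u\neq0$ and satisfies $\boldsymbol e(0)=\lim_{u\to+0}\hat\gamma'(u)/|\hat\gamma'(u)|$; $\boldsymbol\nu(u)=\nu(u,0)$; $\boldsymbol b=-\boldsymbol e\times\boldsymbol\nu$. The invariants are defined by $\boldsymbol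 e'=\tilde\kappa_g\boldsymbol b+\tilde\kappa_\nu\boldsymbol\nu$, $\boldsymbol b'=-\tilde\kappa_g\boldsymbol e+\tilde\kappa_t\boldsymbol\nu$, $\boldsymbol\nu'=-\tilde\kappa_\nu\boldsymbol e-\tilde\kappa_t\boldsymbol b$. Osculating and normal developable surfaces ($(u,t)\in I\times\mathbb{R}$), defined under the hypotheses of (A) and (B) respectively: $$OD_f(u,t)=f(u,0)+t\,\overline{D_o}(u),\quad \overline{D_o}=\frac{\tilde\kappa_t\boldsymbol e-\tilde\kappa_\nu\boldsymbol b}{\sqrt{\tilde\kappa_t^2+\tilde\kappa_\nu^2}},\qquad ND_f(u,t)=f(u,0)+t\,\overline{D_n}(u),\quad \overline{D_n}=\frac{\tilde\kappa_t\boldsymbol e+\tilde\kappa_g\boldsymbol\nu}{\sqrt{\tilde\kappa_t^2+\tilde\kappa_g^2}}.$$ $$\tilde\delta_o=\tilde\kappa_g(\tilde\kappa_\nu^2+\tilde\kappa_t^2)-\tilde\kappa_t\tilde\kappa_\nu'+\tilde\kappa_t'\tilde\kappa_\nu,\qquad \tilde\delta_n=\tilde\kappa_\nu(\tilde\kappa_g^2+\tilde\kappa_t^2)-\tilde\kappa_g\tilde\kappa_t'+\tilde\kappa_t\tilde\kappa_g'.$$ A ruled surface is a cylinder if all its rulings (the lines $u=\text{const}$) are parallel. For a unit vector $\boldsymbol k\in S^2$, $S(f)$ is the tangential (respectively, normal) contour edge of the orthogonal projection with the direction $\boldsymbol k$ if $S(f)=\{(u,0)\mid\langle\boldsymbol\nu(u),\boldsymbol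 k\rangle=0\}$ (respectively, $S(f)=\{(u,0)\mid\langle\boldsymbol b(u),\boldsymbol k\rangle=0\}$), i.e. the equation holds for all $u\in I$. "With respect to an orthogonal projection" means: for some $\boldsymbol k\in S^2$. *)

theory Defs
  imports "HOL-Analysis.Analysis"
begin

section \<open>Smooth maps\<close>

text \<open>The class C^k on an open set, via iterated directional derivatives; on a Euclidean space
  this agrees with the usual definition. It is only meant for open sets, since the derivatives
  are the unrestricted ones.\<close>

fun Ck_on :: "nat \<Rightarrow> 'a::euclidean_space set \<Rightarrow> ('a \<Rightarrow> 'b::real_normed_vector) \<Rightarrow> bool" where
  "Ck_on 0 U f \<longleftrightarrow> continuous_on U f"
| "Ck_on (Suc k) U f \<longleftrightarrow>
     (\<forall>x\<in>U. f differentiable (at x)) \<and> (\<forall>X. Ck_on k U (\<lambda>x. frechet_derivative f (at x) X))"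

definition smooth_on :: "'a::euclidean_space set \<Rightarrow> ('a \<Rightarrow> 'b::real_normed_vector) \<Rightarrow> bool" where
  "smooth_on U f \<longleftrightarrow> (\<forall>k. Ck_on k U f)"

section \<open>Frontals and singular points of the second kind\<close>

text \<open>A germ at the origin is given by a representative on an open neighbourhood \<open>U\<close>.\<close>

definition frontal_germ :: "(real^2) set \<Rightarrow> (real^2 \<Rightarrow> real^3) \<Rightarrow> (real^2 \<Rightarrow> real^3) \<Rightarrow> bool" where
  "frontal_germ U f \<nu> \<longleftrightarrow>
     open U \<and> 0 \<in> U \<and> smooth_on U f \<and> f 0 = 0 \<and>
     smooth_on U \<nu> \<and> \<nu> ` U \<subseteq> sphere 0 1 \<and>
     (\<forall>p\<in>U. \<forall>X. frechet_derivative f (at p) X \<bullet> \<nu> p = 0)"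

definition singular_set :: "(real^2) set \<Rightarrow> (real^2 \<Rightarrow> real^3) \<Rightarrow> (real^2) set" where
  "singular_set U f = {p\<in>U. \<not> inj (frechet_derivative f (at p))}"

text \<open>The function \<open>det(f_u, f_v, \<nu>)\<close>.\<close>

definition signed_area_density :: "(real^2 \<Rightarrow> real^3) \<Rightarrow> (real^2 \<Rightarrow> real^3) \<Rightarrow> real^2 \<Rightarrow> real" where
  "signed_area_density f \<nu> p =
     det (vector [frechet_derivative f (at p) (axis 1 1), frechet_derivative f (at p) (axis 2 1), \<nu> p]
          :: real^3^3)"

definition nondegenerate_singular_point ::
    "(real^2) set \<Rightarrow> (real^2 \<Rightarrow> real^3) \<Rightarrow> (real^2 \<Rightarrow> real^3) \<Rightarrow> real^2 \<Rightarrow> bool" where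
  "nondegenerate_singular_point U f \<nu> p \<longleftrightarrow>
     p \<in> singular_set U f \<and>
     frechet_derivative (signed_area_density f \<nu>) (at p) \<noteq> (\<lambda>X. 0)"

definition open_interval_around_0 :: "real set \<Rightarrow> bool" where
  "open_interval_around_0 I \<longleftrightarrow> open I \<and> is_interval I \<and> 0 \<in> I"

text \<open>\<open>\<gamma>\<close> parameterizes the singular set near \<open>p = \<gamma> 0\<close> as a regular curve and \<open>\<eta>\<close> is a null
  vector field along \<open>\<gamma>\<close>.\<close>

definition singular_curve_with_null_field ::
    "(real^2) set \<Rightarrow> (real^2 \<Rightarrow> real^3) \<Rightarrow> real^2 \<Rightarrow> real set \<Rightarrow> (real \<Rightarrow> real^2) \<Rightarrow> (real \<Rightarrow> real^2) \<Rightarrow> bool"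
where
  "singular_curve_with_null_field U f p J \<gamma> \<eta> \<longleftrightarrow>
     open_interval_around_0 J \<and> smooth_on J \<gamma> \<and> \<gamma> 0 = p \<and>
     (\<forall>t\<in>J. vector_derivative \<gamma> (at t) \<noteq> 0) \<and>
     (\<exists>V. open V \<and> p \<in> V \<and> \<gamma> ` J = singular_set U f \<inter> V) \<and>
     smooth_on J \<eta> \<and>
     (\<forall>t\<in>J. \<eta> t \<noteq> 0 \<and> {X. frechet_derivative f (at (\<gamma> t)) X = 0} = span {\<eta> t})"

text \<open>The condition on \<open>\<phi> = det(\<gamma>', \<eta>)\<close> does not depend on the choice of \<open>\<gamma>\<close> and \<open>\<eta>\<close>.\<close>

definition second_kind_singular_point ::
    "(real^2) set \<Rightarrow> (real^2 \<Rightarrow> real^3) \<Rightarrow> (real^2 \<Rightarrow> real^3) \<Rightarrow> real^2 \<Rightarrow> bool" where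
  "second_kind_singular_point U f \<nu> p \<longleftrightarrow>
     nondegenerate_singular_point U f \<nu> p \<and>
     (\<exists>J \<gamma> \<eta>. singular_curve_with_null_field U f p J \<gamma> \<eta> \<and>
       (let \<phi> = \<lambda>t. det (vector [vector_derivative \<gamma> (at t), \<eta> t] :: real^2^2)
        in \<phi> 0 = 0 \<and> deriv \<phi> 0 \<noteq> 0))"

section \<open>Adapted coordinates and the Darboux frame\<close>

definition axis_curve :: "real \<Rightarrow> real^2" where
  "axis_curve u = vector [u, 0]"

definition image_curve :: "(real^2 \<Rightarrow> real^3) \<Rightarrow> real \<Rightarrow> real^3" where
  "image_curve f u = f (axis_curve u)"

definition curve_derivative :: "(real \<Rightarrow> real^3) \<Rightarrow> real \<Rightarrow> real^3" where
  "curve_derivative c u = vector_derivative c (at u)"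

text \<open>The interval \<open>I\<close> on which the singular curve is considered is the full trace of \<open>U\<close> on the
  first coordinate axis; smaller intervals are obtained by shrinking \<open>U\<close>.\<close>

definition adapted_coordinates ::
    "(real^2) set \<Rightarrow> (real^2 \<Rightarrow> real^3) \<Rightarrow> (real^2 \<Rightarrow> real^3) \<Rightarrow> real set \<Rightarrow> bool" where
  "adapted_coordinates U f \<nu> I \<longleftrightarrow>
     open_interval_around_0 I \<and>
     singular_set U f = {p\<in>U. p $ 2 = 0} \<and>
     axis_curve ` I = {p\<in>U. p $ 2 = 0} \<and>
     det (vector [(curve_derivative ^^ 2) (image_curve f) 0,
                  (curve_derivative ^^ 3) (image_curve f) 0,
                  \<nu> 0] :: real^3^3) > 0"

text \<open>As \<open>e u\<close> is a unit vector, the tangency condition includes that the image of the singular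
  curve is regular at every \<open>u \<noteq> 0\<close> in \<open>I\<close>, which is what taking \<open>I\<close> small achieves.\<close>

definition darboux_frame ::
    "(real^2 \<Rightarrow> real^3) \<Rightarrow> (real^2 \<Rightarrow> real^3) \<Rightarrow> real set \<Rightarrow>
     (real \<Rightarrow> real^3) \<Rightarrow> (real \<Rightarrow> real^3) \<Rightarrow> (real \<Rightarrow> real^3) \<Rightarrow> bool" where
  "darboux_frame f \<nu> I e b n \<longleftrightarrow>
     smooth_on I e \<and>
     (\<forall>u\<in>I. norm (e u) = 1) \<and>
     (\<forall>u\<in>I - {0}. e u \<in> span {curve_derivative (image_curve f) u}) \<and>
     ((\<lambda>u. curve_derivative (image_curve f) u /\<^sub>R norm (curve_derivative (image_curve f) u))
        \<longlongrightarrow> e 0) (at_right 0) \<and>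
     (\<forall>u\<in>I. n u = \<nu> (axis_curve u) \<and> b u = - cross3 (e u) (n u))"

definition darboux_invariants ::
    "real set \<Rightarrow> (real \<Rightarrow> real^3) \<Rightarrow> (real \<Rightarrow> real^3) \<Rightarrow> (real \<Rightarrow> real^3) \<Rightarrow>
     (real \<Rightarrow> real) \<Rightarrow> (real \<Rightarrow> real) \<Rightarrow> (real \<Rightarrow> real) \<Rightarrow> bool" where
  "darboux_invariants I e b n \<kappa>\<^sub>g \<kappa>\<^sub>\<nu> \<kappa>\<^sub>t \<longleftrightarrow>
     (\<forall>u\<in>I.
       (e has_vector_derivative (\<kappa>\<^sub>g u *\<^sub>R b u + \<kappa>\<^sub>\<nu> u *\<^sub>R n u)) (at u) \<and>
       (b has_vector_derivative (- \<kappa>\<^sub>g u *\<^sub>R e u + \<kappa>\<^sub>t u *\<^sub>R n u)) (at u) \<and>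
       (n has_vector_derivative (- \<kappa>\<^sub>\<nu> u *\<^sub>R e u - \<kappa>\<^sub>t u *\<^sub>R b u)) (at u))"

definition delta_o :: "(real \<Rightarrow> real) \<Rightarrow> (real \<Rightarrow> real) \<Rightarrow> (real \<Rightarrow> real) \<Rightarrow> real \<Rightarrow> real" where
  "delta_o \<kappa>\<^sub>g \<kappa>\<^sub>\<nu> \<kappa>\<^sub>t u =
     \<kappa>\<^sub>g u * ((\<kappa>\<^sub>\<nu> u)\<^sup>2 + (\<kappa>\<^sub>t u)\<^sup>2) - \<kappa>\<^sub>t u * deriv \<kappa>\<^sub>\<nu> u + deriv \<kappa>\<^sub>t u * \<kappa>\<^sub>\<nu> u"

definition delta_n :: "(real \<Rightarrow> real) \<Rightarrow> (real \<Rightarrow> real) \<Rightarrow> (real \<Rightarrow> real) \<Rightarrow> real \<Rightarrow> real" where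
  "delta_n \<kappa>\<^sub>g \<kappa>\<^sub>\<nu> \<kappa>\<^sub>t u =
     \<kappa>\<^sub>\<nu> u * ((\<kappa>\<^sub>g u)\<^sup>2 + (\<kappa>\<^sub>t u)\<^sup>2) - \<kappa>\<^sub>g u * deriv \<kappa>\<^sub>t u + \<kappa>\<^sub>t u * deriv \<kappa>\<^sub>g u"

section \<open>Osculating and normal developable surfaces\<close>

definition osculating_direction ::
    "(real \<Rightarrow> real^3) \<Rightarrow> (real \<Rightarrow> real^3) \<Rightarrow> (real \<Rightarrow> real) \<Rightarrow> (real \<Rightarrow> real) \<Rightarrow> real \<Rightarrow> real^3" where
  "osculating_direction e b \<kappa>\<^sub>\<nu> \<kappa>\<^sub>t u =
     (\<kappa>\<^sub>t u *\<^sub>R e u - \<kappa>\<^sub>\<nu> u *\<^sub>R b u) /\<^sub>R sqrt ((\<kappa>\<^sub>t u)\<^sup>2 + (\<kappa>\<^sub>\<nu> u)\<^sup>2)"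

definition normal_direction ::
    "(real \<Rightarrow> real^3) \<Rightarrow> (real \<Rightarrow> real^3) \<Rightarrow> (real \<Rightarrow> real) \<Rightarrow> (real \<Rightarrow> real) \<Rightarrow> real \<Rightarrow> real^3" where
  "normal_direction e n \<kappa>\<^sub>g \<kappa>\<^sub>t u =
     (\<kappa>\<^sub>t u *\<^sub>R e u + \<kappa>\<^sub>g u *\<^sub>R n u) /\<^sub>R sqrt ((\<kappa>\<^sub>t u)\<^sup>2 + (\<kappa>\<^sub>g u)\<^sup>2)"

definition ruled_surface :: "(real \<Rightarrow> real^3) \<Rightarrow> (real \<Rightarrow> real^3) \<Rightarrow> real \<Rightarrow> real \<Rightarrow> real^3" where
  "ruled_surface c D u t = c u + t *\<^sub>R D u"

definition osculating_developable ::
    "(real^2 \<Rightarrow> real^3) \<Rightarrow> (real \<Rightarrow> real^3) \<Rightarrow> (real \<Rightarrow> real^3) \<Rightarrow> (real \<Rightarrow> real) \<Rightarrow> (real \<Rightarrow> real) \<Rightarrow>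
     real \<Rightarrow> real \<Rightarrow> real^3" where
  "osculating_developable f e b \<kappa>\<^sub>\<nu> \<kappa>\<^sub>t =
     ruled_surface (image_curve f) (osculating_direction e b \<kappa>\<^sub>\<nu> \<kappa>\<^sub>t)"

definition normal_developable ::
    "(real^2 \<Rightarrow> real^3) \<Rightarrow> (real \<Rightarrow> real^3) \<Rightarrow> (real \<Rightarrow> real^3) \<Rightarrow> (real \<Rightarrow> real) \<Rightarrow> (real \<Rightarrow> real) \<Rightarrow>
     real \<Rightarrow> real \<Rightarrow> real^3" where
  "normal_developable f e n \<kappa>\<^sub>g \<kappa>\<^sub>t =
     ruled_surface (image_curve f) (normal_direction e n \<kappa>\<^sub>g \<kappa>\<^sub>t)"

text \<open>The rulings are the lines \<open>range (F u)\<close>. Lines are parallel if one is a translate of the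
  other; coincident lines count as parallel.\<close>

definition cylinder :: "real set \<Rightarrow> (real \<Rightarrow> real \<Rightarrow> real^3) \<Rightarrow> bool" where
  "cylinder I F \<longleftrightarrow> (\<forall>u\<in>I. \<forall>w\<in>I. affine_parallel (range (F u)) (range (F w)))"

section \<open>Great circles and contour edges\<close>

definition great_circle :: "(real^3) set \<Rightarrow> bool" where
  "great_circle C \<longleftrightarrow> (\<exists>P. subspace P \<and> dim P = 2 \<and> C = sphere 0 1 \<inter> P)"

definition part_of_great_circle :: "real set \<Rightarrow> (real \<Rightarrow> real^3) \<Rightarrow> bool" where
  "part_of_great_circle I c \<longleftrightarrow> (\<exists>C. great_circle C \<and> c ` I \<subseteq> C)"

text \<open>The tangential contour edge for the direction \<open>k\<close> is the case \<open>w = n\<close>, the normal one the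
  case \<open>w = b\<close>.\<close>

definition contour_edge ::
    "(real^2) set \<Rightarrow> (real^2 \<Rightarrow> real^3) \<Rightarrow> real set \<Rightarrow> (real \<Rightarrow> real^3) \<Rightarrow> real^3 \<Rightarrow> bool" where
  "contour_edge U f I w k \<longleftrightarrow> singular_set U f = {axis_curve u | u. u \<in> I \<and> w u \<bullet> k = 0}"

end

theory Submission
  imports Defs
begin

text \<open>Writing \<open>w\<close> for \<open>\<nu>\<close> (resp. \<open>b\<close>), the unnormalized direction is orthogonal to \<open>w\<close> and \<open>w'\<close>, and
  the derivative of the normalized direction \<open>D\<close> is a multiple of \<open>\<delta>\<close>; so \<open>\<delta> = 0\<close> makes \<open>D\<close> constant,
  and then the surface is a cylinder. On a cylinder, \<open>D 0\<close> is a multiple of every \<open>D u\<close>, hence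
  orthogonal to every \<open>w u\<close>. Finally, if a fixed \<open>k \<noteq> 0\<close> is orthogonal to \<open>w\<close>, differentiating
  \<open>\<langle>w, k\<rangle> = 0\<close> twice gives two linear equations for the components of \<open>k\<close> along the other two
  frame vectors, whose determinant is \<open>\<delta>\<close>. The normal case is the osculating case for the frame
  \<open>(e, -\<nu>, b)\<close>.\<close>

text \<open>Both parts of the theorem are instances of this frame: \<open>w\<close> is the vector
  tested against great circles, and the names are arranged so that
  \<open>delta_o \<gamma> \<alpha> \<beta>\<close> and
  \<open>osculating_direction p q \<alpha> \<beta>\<close> are the relevant objects. Of the
  coefficients, only \<open>\<alpha>\<close> and \<open>\<beta>\<close> get differentiated in
  \<open>delta_o\<close>.\<close>

locale moving_frame =
  fixes I :: "real set" and p q w :: "real \<Rightarrow> real^3" and \<alpha> \<beta> \<gamma> :: "real \<Rightarrow> real"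
  assumes interval: "open_interval_around_0 I"
    and norm_p: "u \<in> I \<Longrightarrow> norm (p u) = 1"
    and norm_q: "u \<in> I \<Longrightarrow> norm (q u) = 1"
    and norm_w: "u \<in> I \<Longrightarrow> norm (w u) = 1"
    and orth: "u \<in> I \<Longrightarrow> p u \<bullet> q u = 0" "u \<in> I \<Longrightarrow> p u \<bullet> w u = 0" "u \<in> I \<Longrightarrow> q u \<bullet> w u = 0"
    and deriv_p: "u \<in> I \<Longrightarrow> (p has_vector_derivative \<gamma> u *\<^sub>R q u + \<alpha> u *\<^sub>R w u) (at u)"
    and deriv_q: "u \<in> I \<Longrightarrow> (q has_vector_derivative - \<gamma> u *\<^sub>R p u + \<beta> u *\<^sub>R w u) (at u)"
    and deriv_w: "u \<in> I \<Longrightarrow> (w has_vector_derivative - \<alpha> u *\<^sub>R p u - \<beta> u *\<^sub>R q u) (at u)"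
    and differentiable: "u \<in> I \<Longrightarrow> \<alpha> differentiable (at u)" "u \<in> I \<Longrightarrow> \<beta> differentiable (at u)"
    and nonzero: "u \<in> I \<Longrightarrow> (\<beta> u)\<^sup>2 + (\<alpha> u)\<^sup>2 \<noteq> 0"
begin

abbreviation "D \<equiv> osculating_direction p q \<alpha> \<beta>"
abbreviation "\<delta> \<equiv> delta_o \<gamma> \<alpha> \<beta>"

section \<open>The normalized ruling direction\<close>

lemma zero_in: "0 \<in> I" and open_I: "open I" and convex_I: "convex I"
  using interval by (auto simp: open_interval_around_0_def is_interval_convex)

lemma DERIV_coeffs:
  assumes "u \<in> I"
  shows "(\<alpha> has_real_derivative deriv \<alpha> u) (at u)" "(\<beta> has_real_derivative deriv \<beta> u) (at u)"
  using differentiable[OF assms] by (simp_all add: DERIV_deriv_iff_real_differentiable)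

lemma inner_direction:
  assumes "u \<in> I"
  shows "w u \<bullet> D u = 0"
  using orth[OF assms] by (simp add: osculating_direction_def inner_diff_right inner_commute)

text \<open>This makes \<open>D 0\<close> admissible as the unit projection direction
  \<open>k\<close> later on.\<close>

lemma norm_direction:
  assumes "u \<in> I"
  shows "norm (D u) = 1"
proof -
  have "(norm (\<beta> u *\<^sub>R p u - \<alpha> u *\<^sub>R q u))\<^sup>2 = (\<beta> u)\<^sup>2 + (\<alpha> u)\<^sup>2"
    using norm_p[OF assms] norm_q[OF assms] orth(1)[OF assms]
    unfolding norm_eq_1 power2_norm_eq_inner
    by (simp add: inner_diff_left inner_diff_right inner_commute power2_eq_square)
  then have "norm (\<beta> u *\<^sub>R p u - \<alpha> u *\<^sub>R q u) = sqrt ((\<beta> u)\<^sup>2 + (\<alpha> u)\<^sup>2)"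
    by (metis norm_ge_zero real_sqrt_unique)
  then show ?thesis
    using nonzero[OF assms] by (simp add: osculating_direction_def)
qed

text \<open>Write \<open>D\<close> as x p - y q, so that D' = (x' + \<gamma> y) p + (\<gamma> x -
  y') q + (x \<alpha> - y \<beta>) w. The last coefficient vanishes identically. Vanishing of
  \<open>\<delta> u\<close> says that the unit vector (x, y) turns so as to cancel the rotation
  \<gamma> of the frame: x' = -\<gamma> y and y' = \<gamma> x.\<close>

lemma direction_has_derivative_0:
  assumes u: "u \<in> I" and \<delta>: "\<delta> u = 0"
  shows "(D has_vector_derivative 0) (at u)"
proof -
  let ?r = "\<lambda>u. sqrt ((\<beta> u)\<^sup>2 + (\<alpha> u)\<^sup>2)"
  define x where "x = (\<lambda>u. \<beta> u / ?r u)"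
  define y where "y = (\<lambda>u. \<alpha> u / ?r u)"
  define r where "r = ?r u"
  have pos: "(\<beta> u)\<^sup>2 + (\<alpha> u)\<^sup>2 > 0"
    using nonzero[OF u] by (simp add: order_less_le)
  then have r: "r > 0" "r\<^sup>2 = (\<beta> u)\<^sup>2 + (\<alpha> u)\<^sup>2"
    by (auto simp: r_def)
  \<comment> \<open>This is \<open>\<delta> u = 0\<close> solved for the factor common to the
    numerators of x' and y'.\<close>
  have eq: "\<alpha> u * deriv \<beta> u - \<beta> u * deriv \<alpha> u = - \<gamma> u * r\<^sup>2"
    using \<delta> by (simp add: delta_o_def r(2) algebra_simps)
  have r': "(?r has_real_derivative (\<beta> u * deriv \<beta> u + \<alpha> u * deriv \<alpha> u) / r) (at u)"
    using pos unfolding r_def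
    by (auto intro!: derivative_eq_intros DERIV_coeffs[OF u] simp: divide_simps)
  \<comment> \<open>The left side has the shape produced by the quotient rule; clearing the inner
    fraction exposes \<open>r\<^sup>2\<close>, which can then be replaced by the sum of
    squares.\<close>
  have "(deriv \<beta> u * r - \<beta> u * ((\<beta> u * deriv \<beta> u + \<alpha> u * deriv \<alpha> u) / r)) / (r * r)
      = (deriv \<beta> u * r\<^sup>2 - \<beta> u * (\<beta> u * deriv \<beta> u + \<alpha> u * deriv \<alpha> u)) / (r * r\<^sup>2)"
    using r(1) by (simp add: field_simps power2_eq_square)
  also have "deriv \<beta> u * r\<^sup>2 - \<beta> u * (\<beta> u * deriv \<beta> u + \<alpha> u * deriv \<alpha> u)
      = \<alpha> u * (\<alpha> u * deriv \<beta> u - \<beta> u * deriv \<alpha> u)"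
    unfolding r(2) by algebra
  also have "\<dots> / (r * r\<^sup>2) = - \<gamma> u * y u"
    unfolding eq using r(1) by (simp add: y_def flip: r_def)
  finally have "(deriv \<beta> u * r - \<beta> u * ((\<beta> u * deriv \<beta> u + \<alpha> u * deriv \<alpha> u) / r)) / (r * r) = - \<gamma> u * y u" .
  then have x': "(x has_real_derivative - \<gamma> u * y u) (at u)"
    unfolding x_def
    using DERIV_divide[OF DERIV_coeffs(2)[OF u] r', folded r_def] r(1) by simp
  have "(deriv \<alpha> u * r - \<alpha> u * ((\<beta> u * deriv \<beta> u + \<alpha> u * deriv \<alpha> u) / r)) / (r * r)
      = (deriv \<alpha> u * r\<^sup>2 - \<alpha> u * (\<beta> u * deriv \<beta> u + \<alpha> u * deriv \<alpha> u)) / (r * r\<^sup>2)"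
    using r(1) by (simp add: field_simps power2_eq_square)
  also have "deriv \<alpha> u * r\<^sup>2 - \<alpha> u * (\<beta> u * deriv \<beta> u + \<alpha> u * deriv \<alpha> u)
      = - \<beta> u * (\<alpha> u * deriv \<beta> u - \<beta> u * deriv \<alpha> u)"
    unfolding r(2) by algebra
  also have "\<dots> / (r * r\<^sup>2) = \<gamma> u * x u"
    unfolding eq using r(1) by (simp add: x_def flip: r_def)
  finally have "(deriv \<alpha> u * r - \<alpha> u * ((\<beta> u * deriv \<beta> u + \<alpha> u * deriv \<alpha> u) / r)) / (r * r) = \<gamma> u * x u" .
  then have y': "(y has_real_derivative \<gamma> u * x u) (at u)"
    unfolding y_def
    using DERIV_divide[OF DERIV_coeffs(1)[OF u] r', folded r_def] r(1) by simp
  have D: "D = (\<lambda>u. x u *\<^sub>R p u - y u *\<^sub>R q u)"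
    by (auto simp: osculating_direction_def x_def y_def scaleR_diff_right divide_inverse mult.commute)
  have xy: "x u * \<alpha> u = y u * \<beta> u"
    by (simp add: x_def y_def)
  have "((\<lambda>u. x u *\<^sub>R p u - y u *\<^sub>R q u) has_vector_derivative
     (x u *\<^sub>R (\<gamma> u *\<^sub>R q u + \<alpha> u *\<^sub>R w u) + (- \<gamma> u * y u) *\<^sub>R p u)
     - (y u *\<^sub>R (- \<gamma> u *\<^sub>R p u + \<beta> u *\<^sub>R w u) + (\<gamma> u * x u) *\<^sub>R q u)) (at u)"
    by (intro has_vector_derivative_diff has_vector_derivative_scaleR x' y' deriv_p deriv_q u)
  moreover have "(x u *\<^sub>R (\<gamma> u *\<^sub>R q u + \<alpha> u *\<^sub>R w u) + (- \<gamma> u * y u) *\<^sub>R p u)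
     - (y u *\<^sub>R (- \<gamma> u *\<^sub>R p u + \<beta> u *\<^sub>R w u) + (\<gamma> u * x u) *\<^sub>R q u) = 0"
    using xy by (simp add: algebra_simps)
  ultimately show ?thesis
    unfolding D by metis
qed

lemma delta_0_imp_direction_constant:
  assumes "\<forall>u\<in>I. \<delta> u = 0"
  shows "D constant_on I"
proof -
  have "\<exists>c. \<forall>u\<in>I. D u = c"
    using has_vector_derivative_zero_constant[OF convex_I, of D]
      direction_has_derivative_0 assms has_vector_derivative_at_within by metis
  then show ?thesis
    by (auto simp: constant_on_def)
qed

lemma direction_constant_imp_cylinder:
  assumes "D constant_on I"
  shows "cylinder I (ruled_surface c D)"
  unfolding cylinder_def
proof (intro ballI)
  fix u v assume "u \<in> I" "v \<in> I"
  then have "D u = D v"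
    using assms by (auto simp: constant_on_def)
  \<comment> \<open>With a common direction, moving the base point \<open>c u\<close> to
    \<open>c v\<close> carries one ruling onto the other.\<close>
  then have "range (ruled_surface c D v) = (+) (c v - c u) ` range (ruled_surface c D u)"
    by (simp add: image_image ruled_surface_def)
  then show "affine_parallel (range (ruled_surface c D u)) (range (ruled_surface c D v))"
    by (auto simp: affine_parallel_def)
qed

lemma cylinder_imp_orthogonal:
  assumes "cylinder I (ruled_surface c D)"
  shows "\<exists>k\<in>sphere 0 1. \<forall>u\<in>I. w u \<bullet> k = 0"
proof (intro bexI ballI)
  fix u assume u: "u \<in> I"
  then obtain a where "range (ruled_surface c D u) = (+) a ` range (ruled_surface c D 0)"
    using assms zero_in unfolding cylinder_def affine_parallel_def by blast
  \<comment> \<open>The points with parameters 0 and 1 on the ruling at 0 differ by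
    \<open>D 0\<close>. Their translates lie on the ruling at \<open>u\<close>, so they differ by a
    multiple of \<open>D u\<close>; the base curve drops out.\<close>
  then have "a + ruled_surface c D 0 t \<in> range (ruled_surface c D u)" for t
    by blast
  then obtain s t where st: "a + ruled_surface c D 0 0 = ruled_surface c D u s"
    "a + ruled_surface c D 0 1 = ruled_surface c D u t"
    by (meson rangeE)
  have "D 0 = ruled_surface c D u t - ruled_surface c D u s"
    unfolding st[symmetric] by (simp add: ruled_surface_def)
  then have "D 0 = t *\<^sub>R D u - s *\<^sub>R D u"
    by (simp add: ruled_surface_def)
  then show "w u \<bullet> D 0 = 0"
    using inner_direction[OF u] by (simp add: inner_diff_right)
next
  show "D 0 \<in> sphere 0 1"
    using norm_direction[OF zero_in] by simp
qed

section \<open>Fixed vectors orthogonal to the curve \<open>w\<close>\<close>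

lemma orthogonal_frame_imp_0:
  assumes u: "u \<in> I" and k: "p u \<bullet> k = 0" "q u \<bullet> k = 0" "w u \<bullet> k = 0"
  shows "k = 0"
proof (rule ccontr)
  assume "k \<noteq> 0"
  \<comment> \<open>A nonzero \<open>k\<close> would complete the frame to four independent vectors
    in a space of dimension three.\<close>
  let ?B = "{p u, q u, w u, k}"
  have ne: "p u \<noteq> 0" "q u \<noteq> 0" "w u \<noteq> 0"
    using norm_p[OF u] norm_q[OF u] norm_w[OF u] by auto
  have "pairwise orthogonal ?B"
    using orth[OF u] k by (auto simp: pairwise_insert orthogonal_def inner_commute)
  then have "independent ?B"
    by (rule pairwise_orthogonal_independent) (use ne \<open>k \<noteq> 0\<close> in auto)
  moreover have "card ?B = 4"
  proof -
    have "p u \<noteq> q u" "p u \<noteq> w u" "q u \<noteq> w u" "p u \<noteq> k" "q u \<noteq> k" "w u \<noteq> k"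
      using orth[OF u] k ne by auto
    then show ?thesis by simp
  qed
  ultimately show False
    using independent_bound[of ?B] by simp
qed

text \<open>With P and Q the components of \<open>k\<close> along \<open>p\<close> and
  \<open>q\<close>, two differentiations give \<alpha> P + \<beta> Q = 0 and (\<alpha>' - \<beta>
  \<gamma>) P + (\<beta>' + \<alpha> \<gamma>) Q = 0. The determinant is \<delta>, and P, Q cannot
  both vanish because \<open>k\<close> is nonzero and orthogonal to \<open>w\<close>.\<close>

lemma orthogonal_imp_delta_0:
  assumes k: "k \<noteq> 0" "\<forall>u\<in>I. w u \<bullet> k = 0" and u: "u \<in> I"
  shows "\<delta> u = 0"
proof -
  \<comment> \<open>The functions vanish only on \<open>I\<close>; its openness still determines the
    two-sided derivative.\<close>
  have deriv_eq_0: "g' = 0"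
    if "(g has_real_derivative g') (at v)" "v \<in> I" "\<forall>x\<in>I. g x = 0" for g :: "real \<Rightarrow> real" and g' v
  proof -
    have "((\<lambda>x. 0) has_real_derivative g') (at v)"
      by (rule has_field_derivative_transform_within_open[OF that(1) open_I that(2)])
        (use that(3) in simp)
    then show ?thesis
      using DERIV_unique[OF _ DERIV_const] by blast
  qed
  have inner_deriv: "((\<lambda>u. g u \<bullet> k) has_real_derivative g' \<bullet> k) (at v)"
    if "(g has_vector_derivative g') (at v)" for g :: "real \<Rightarrow> real^3" and g' v
    using bounded_linear.has_vector_derivative[OF bounded_linear_inner_left that]
    by (simp add: has_real_derivative_iff_has_vector_derivative)
  have first: "\<alpha> v * (p v \<bullet> k) + \<beta> v * (q v \<bullet> k) = 0" if "v \<in> I" for v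
    using deriv_eq_0[OF inner_deriv[OF deriv_w[OF that]] that k(2)]
    by (simp add: inner_diff_left)
  have "((\<lambda>v. \<alpha> v * (p v \<bullet> k) + \<beta> v * (q v \<bullet> k)) has_real_derivative
      deriv \<alpha> u * (p u \<bullet> k) + (\<gamma> u *\<^sub>R q u + \<alpha> u *\<^sub>R w u) \<bullet> k * \<alpha> u
      + (deriv \<beta> u * (q u \<bullet> k) + (- \<gamma> u *\<^sub>R p u + \<beta> u *\<^sub>R w u) \<bullet> k * \<beta> u)) (at u)"
    by (intro DERIV_add DERIV_mult inner_deriv deriv_p deriv_q DERIV_coeffs u)
  \<comment> \<open>The contributions of \<open>w u \<bullet> k\<close> drop out by the choice of
    \<open>k\<close>.\<close>
  from deriv_eq_0[OF this u]
  have second: "(deriv \<alpha> u - \<beta> u * \<gamma> u) * (p u \<bullet> k) + (deriv \<beta> u + \<alpha> u * \<gamma> u) * (q u \<bullet> k) = 0"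
    using first k(2) u by (simp add: inner_add_left algebra_simps)
  \<comment> \<open>Cramer's rule: eliminate one component at a time.\<close>
  have "\<delta> u * (p u \<bullet> k) = 0" "\<delta> u * (q u \<bullet> k) = 0"
    unfolding delta_o_def using first[OF u] second by algebra+
  then show ?thesis
    using orthogonal_frame_imp_0[OF u] k u by auto
qed

text \<open>A great circle is cut out by a plane through the origin, and such a plane is the
  orthogonal complement of a unit normal.\<close>

lemma part_of_great_circle_iff:
  "part_of_great_circle I w \<longleftrightarrow> (\<exists>k\<in>sphere 0 1. \<forall>u\<in>I. w u \<bullet> k = 0)"
proof
  assume "part_of_great_circle I w"
  then obtain P where P: "subspace P" "dim P = 2" "w ` I \<subseteq> P"
    by (auto simp: part_of_great_circle_def great_circle_def)
  then obtain k where k: "k \<noteq> 0" "\<And>y. y \<in> span P \<Longrightarrow> orthogonal k y"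
    using orthogonal_to_subspace_exists[of P] by auto
  have "w u \<bullet> k = 0" if "u \<in> I" for u
    using k(2)[OF span_base, of "w u"] P(3) that by (auto simp: orthogonal_def inner_commute)
  then show "\<exists>k\<in>sphere 0 1. \<forall>u\<in>I. w u \<bullet> k = 0"
    using k(1) by (intro bexI[of _ "k /\<^sub>R norm k"]) auto
next
  assume "\<exists>k\<in>sphere 0 1. \<forall>u\<in>I. w u \<bullet> k = 0"
  then obtain k where k: "norm k = 1" "\<forall>u\<in>I. w u \<bullet> k = 0"
    by auto
  then have "dim {x. k \<bullet> x = 0} = 2"
    using dim_hyperplane[of k] by fastforce
  moreover have "w ` I \<subseteq> sphere 0 1 \<inter> {x. k \<bullet> x = 0}"
    using k norm_w by (auto simp: inner_commute)
  ultimately show "part_of_great_circle I w"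
    unfolding part_of_great_circle_def great_circle_def
    using subspace_hyperplane by blast
qed

text \<open>Existence of a unit vector orthogonal to \<open>w\<close> is the hub to which every
  condition is compared. The preceding lemmas close the cycle: \<delta> = 0, constant
  \<open>D\<close>, cylinder, orthogonal vector, \<delta> = 0. The base curve \<open>c\<close> is
  arbitrary.\<close>

lemma direction_constant_iff_orthogonal:
  "D constant_on I \<longleftrightarrow> (\<exists>k\<in>sphere 0 1. \<forall>u\<in>I. w u \<bullet> k = 0)"
  and delta_0_iff_orthogonal:
  "(\<forall>u\<in>I. \<delta> u = 0) \<longleftrightarrow> (\<exists>k\<in>sphere 0 1. \<forall>u\<in>I. w u \<bullet> k = 0)"
  and cylinder_iff_orthogonal:
  "cylinder I (ruled_surface c D) \<longleftrightarrow> (\<exists>k\<in>sphere 0 1. \<forall>u\<in>I. w u \<bullet> k = 0)"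
proof -
  have "\<forall>u\<in>I. \<delta> u = 0" if "\<exists>k\<in>sphere 0 1. \<forall>u\<in>I. w u \<bullet> k = 0"
    using that orthogonal_imp_delta_0 by (metis mem_sphere_0 norm_zero zero_neq_one)
  then show "D constant_on I \<longleftrightarrow> (\<exists>k\<in>sphere 0 1. \<forall>u\<in>I. w u \<bullet> k = 0)"
    and "(\<forall>u\<in>I. \<delta> u = 0) \<longleftrightarrow> (\<exists>k\<in>sphere 0 1. \<forall>u\<in>I. w u \<bullet> k = 0)"
    and "cylinder I (ruled_surface c D) \<longleftrightarrow> (\<exists>k\<in>sphere 0 1. \<forall>u\<in>I. w u \<bullet> k = 0)"
    using delta_0_imp_direction_constant direction_constant_imp_cylinder cylinder_imp_orthogonal
    by blast+
qed

end

section \<open>Differentiation of smooth maps along the coordinate axis\<close>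

lemma smooth_on_imp_differentiable:
  "smooth_on U g \<Longrightarrow> x \<in> U \<Longrightarrow> g differentiable (at x)"
  unfolding smooth_on_def by (metis Ck_on.simps(2))

lemma smooth_on_frechet_derivative:
  "smooth_on U g \<Longrightarrow> smooth_on U (\<lambda>x. frechet_derivative g (at x) X)"
  unfolding smooth_on_def by (metis Ck_on.simps(2))

lemma axis_curve_eq: "axis_curve u = u *\<^sub>R axis 1 1"
  by (simp add: axis_curve_def vec_eq_iff forall_2 axis_def)

lemma inj_axis_curve: "inj axis_curve"
  by (rule injI) (simp add: axis_curve_def vec_eq_iff forall_2)

text \<open>The chain rule, applied below to \<open>f\<close> for tangency, to \<open>\<nu>\<close>
  for its first derivative, and to a partial derivative of \<open>\<nu>\<close> for the
  second.\<close>

lemma has_vector_derivative_along_axis_curve: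
  assumes "smooth_on U g" "axis_curve u \<in> U"
  shows "((\<lambda>u. g (axis_curve u)) has_vector_derivative
    frechet_derivative g (at (axis_curve u)) (axis 1 1)) (at u)"
proof -
  have "(g has_derivative frechet_derivative g (at (axis_curve u))) (at (axis_curve u))"
    using smooth_on_imp_differentiable[OF assms] by (simp add: frechet_derivative_works)
  moreover have "(axis_curve has_vector_derivative axis 1 1) (at u)"
    unfolding axis_curve_eq has_vector_derivative_def by (auto intro!: derivative_eq_intros)
  ultimately show ?thesis
    using vector_derivative_diff_chain_within[of axis_curve "axis 1 1" u UNIV g]
    by (simp add: o_def has_derivative_at_withinI)
qed

lemma has_vector_derivative_frechet_derivative:
  fixes g :: "real \<Rightarrow> 'b::real_normed_vector"
  assumes "g differentiable (at u)"
  shows "(g has_vector_derivative frechet_derivative g (at u) 1) (at u)"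
  using assms by (simp add: frechet_derivative_eq_vector_derivative flip: vector_derivative_works)

lemma differentiable_inner:
  fixes g h :: "real \<Rightarrow> 'b::real_inner"
  assumes "g differentiable (at u)" "h differentiable (at u)"
  shows "(\<lambda>x. g x \<bullet> h x) differentiable (at u)"
  using assms unfolding differentiable_def by (blast intro: has_derivative_inner)

text \<open>This passes differentiability to the invariants, which are identified with explicit
  inner products only on \<open>I\<close>.\<close>

lemma differentiable_transform_open:
  fixes g h :: "real \<Rightarrow> 'b::real_normed_vector"
  assumes "g differentiable (at u)" "open S" "u \<in> S" "\<And>x. x \<in> S \<Longrightarrow> g x = h x"
  shows "h differentiable (at u)"
  using assms unfolding differentiable_def by (blast intro: has_derivative_transform_within_open)


theorem theorem4p1:
  fixes U :: "(real^2) set"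
    and f :: "real^2 \<Rightarrow> real^3"
    and \<nu> :: "real^2 \<Rightarrow> real^3"
    and I :: "real set"
    and e b n :: "real \<Rightarrow> real^3"
    and \<kappa>\<^sub>g \<kappa>\<^sub>\<nu> \<kappa>\<^sub>t :: "real \<Rightarrow> real"
  assumes "frontal_germ U f \<nu>"
    and "second_kind_singular_point U f \<nu> 0"
    and "adapted_coordinates U f \<nu> I"
    and "darboux_frame f \<nu> I e b n"
    and "darboux_invariants I e b n \<kappa>\<^sub>g \<kappa>\<^sub>\<nu> \<kappa>\<^sub>t"
  shows
    "((\<forall>u\<in>I. (\<kappa>\<^sub>t u)\<^sup>2 + (\<kappa>\<^sub>\<nu> u)\<^sup>2 \<noteq> 0) \<longrightarrow>
       (cylinder I (osculating_developable f e b \<kappa>\<^sub>\<nu> \<kappa>\<^sub>t)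
          \<longleftrightarrow> (\<forall>u\<in>I. delta_o \<kappa>\<^sub>g \<kappa>\<^sub>\<nu> \<kappa>\<^sub>t u = 0)) \<and>
       ((\<forall>u\<in>I. delta_o \<kappa>\<^sub>g \<kappa>\<^sub>\<nu> \<kappa>\<^sub>t u = 0)
          \<longleftrightarrow> part_of_great_circle I n) \<and>
       (part_of_great_circle I n
          \<longleftrightarrow> (\<exists>k\<in>sphere 0 1. contour_edge U f I n k)) \<and>
       ((\<exists>k\<in>sphere 0 1. contour_edge U f I n k)
          \<longleftrightarrow> osculating_direction e b \<kappa>\<^sub>\<nu> \<kappa>\<^sub>t constant_on I))
     \<and>
     ((\<forall>u\<in>I. (\<kappa>\<^sub>g u)\<^sup>2 + (\<kappa>\<^sub>t u)\<^sup>2 \<noteq> 0) \<longrightarrow>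
       (cylinder I (normal_developable f e n \<kappa>\<^sub>g \<kappa>\<^sub>t)
          \<longleftrightarrow> (\<forall>u\<in>I. delta_n \<kappa>\<^sub>g \<kappa>\<^sub>\<nu> \<kappa>\<^sub>t u = 0)) \<and>
       ((\<forall>u\<in>I. delta_n \<kappa>\<^sub>g \<kappa>\<^sub>\<nu> \<kappa>\<^sub>t u = 0)
          \<longleftrightarrow> part_of_great_circle I b) \<and>
       (part_of_great_circle I b
          \<longleftrightarrow> (\<exists>k\<in>sphere 0 1. contour_edge U f I b k)) \<and>
       ((\<exists>k\<in>sphere 0 1. contour_edge U f I b k)
          \<longleftrightarrow> normal_direction e n \<kappa>\<^sub>g \<kappa>\<^sub>t constant_on I))"
proof -
  have I: "open_interval_around_0 I" "open I"
    and sing: "singular_set U f = axis_curve ` I" and sub: "axis_curve ` I \<subseteq> U"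
    using assms(3) by (auto simp: adapted_coordinates_def open_interval_around_0_def)
  have \<nu>: "smooth_on U \<nu>" "\<nu> ` U \<subseteq> sphere 0 1"
    using assms(1) by (auto simp: frontal_germ_def)
  have e: "smooth_on I e" "\<And>u. u \<in> I \<Longrightarrow> norm (e u) = 1"
    and span: "\<And>u. u \<in> I - {0} \<Longrightarrow> e u \<in> span {curve_derivative (image_curve f) u}"
    and n: "\<And>u. u \<in> I \<Longrightarrow> n u = \<nu> (axis_curve u)"
    and b: "\<And>u. u \<in> I \<Longrightarrow> b u = - cross3 (e u) (n u)"
    using assms(4) by (auto simp: darboux_frame_def)
  have deriv_e: "\<And>u. u \<in> I \<Longrightarrow> (e has_vector_derivative (\<kappa>\<^sub>g u *\<^sub>R b u + \<kappa>\<^sub>\<nu> u *\<^sub>R n u)) (at u)"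
    and deriv_b: "\<And>u. u \<in> I \<Longrightarrow> (b has_vector_derivative (- \<kappa>\<^sub>g u *\<^sub>R e u + \<kappa>\<^sub>t u *\<^sub>R n u)) (at u)"
    and deriv_n: "\<And>u. u \<in> I \<Longrightarrow> (n has_vector_derivative (- \<kappa>\<^sub>\<nu> u *\<^sub>R e u - \<kappa>\<^sub>t u *\<^sub>R b u)) (at u)"
    using assms(5) by (auto simp: darboux_invariants_def)
  have norm_n: "norm (n u) = 1" if "u \<in> I" for u
    using that n \<nu>(2) sub by (fastforce simp: image_subset_iff)
  have orth_eb: "e u \<bullet> b u = 0" and orth_nb: "n u \<bullet> b u = 0" if "u \<in> I" for u
    using b[OF that] by (simp_all add: dot_cross_self)
  \<comment> \<open>Away from 0, \<open>e u\<close> is a multiple of the velocity of the image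
    curve, which lies in the image of the differential of \<open>f\<close>.\<close>
  have orth_en_nonzero: "e u \<bullet> n u = 0" if u: "u \<in> I - {0}" for u
  proof -
    have "smooth_on U f"
      using assms(1) by (simp add: frontal_germ_def)
    then have "curve_derivative (image_curve f) u = frechet_derivative f (at (axis_curve u)) (axis 1 1)"
      unfolding curve_derivative_def image_curve_def
      using sub u by (intro vector_derivative_at has_vector_derivative_along_axis_curve) auto
    then have "curve_derivative (image_curve f) u \<bullet> n u = 0"
      using assms(1) sub u n by (auto simp: frontal_germ_def)
    then show ?thesis
      using span[OF u] by (auto simp: span_singleton)
  qed
  have orth_en: "e u \<bullet> n u = 0" if u: "u \<in> I" for u
  proof (cases "u = 0")
    case True
    \<comment> \<open>Tangency to the velocity is given only for nonzero parameters, so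
      orthogonality at 0 is obtained as a limit.\<close>
    have "isCont (\<lambda>u. e u \<bullet> n u) 0"
      using deriv_e deriv_n u True
      by (intro continuous_intros) (auto intro: has_vector_derivative_continuous)
    then have "((\<lambda>u. e u \<bullet> n u) \<longlongrightarrow> e 0 \<bullet> n 0) (at 0)"
      by (simp add: isCont_def)
    moreover have "eventually (\<lambda>u. e u \<bullet> n u = 0) (at 0)"
      using orth_en_nonzero I(2) u True by (auto simp: eventually_at_topological)
    then have "((\<lambda>u. e u \<bullet> n u) \<longlongrightarrow> 0) (at 0)"
      by (rule tendsto_eventually)
    ultimately show ?thesis
      using True tendsto_unique[of "at (0::real)"] by auto
  qed (use orth_en_nonzero u in auto)
  have norm_b: "norm (b u) = 1" if "u \<in> I" for u
  proof -
    have "(norm (cross3 (e u) (n u)))\<^sup>2 = 1"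
      using norm_cross_dot[of "e u" "n u"] orth_en e(2) norm_n that by simp
    then show ?thesis
      using b[OF that] by (simp add: abs_square_eq_1)
  qed

  \<comment> \<open>The invariants enter only through the frame equations, so their
    differentiability must be derived. They are recovered as
    \<open>\<kappa>\<^sub>\<nu> = - n' \<bullet> e\<close>,
    \<open>\<kappa>\<^sub>t = - n' \<bullet> b\<close> and
    \<open>\<kappa>\<^sub>g = e' \<bullet> b\<close>, where \<open>n'\<close> and \<open>e'\<close>
    are differentiable on \<open>I\<close> because \<open>\<nu>\<close> and \<open>e\<close> are
    smooth.\<close>
  define n' where "n' u = frechet_derivative \<nu> (at (axis_curve u)) (axis 1 1)" for u
  define e' where "e' u = frechet_derivative e (at u) 1" for u
  have n'_eq: "n' u = - \<kappa>\<^sub>\<nu> u *\<^sub>R e u - \<kappa>\<^sub>t u *\<^sub>R b u" if u: "u \<in> I" for u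
  proof -
    have "(n has_vector_derivative n' u) (at u)"
      unfolding n'_def
      by (rule has_vector_derivative_transform_within_open
          [OF has_vector_derivative_along_axis_curve[OF \<nu>(1)] I(2) u]) (use sub u n in auto)
    then show ?thesis
      using vector_derivative_unique_at deriv_n[OF u] by blast
  qed
  have e'_eq: "e' u = \<kappa>\<^sub>g u *\<^sub>R b u + \<kappa>\<^sub>\<nu> u *\<^sub>R n u" if u: "u \<in> I" for u
    unfolding e'_def
    using has_vector_derivative_frechet_derivative[OF smooth_on_imp_differentiable[OF e(1) u]]
      deriv_e[OF u] by (rule vector_derivative_unique_at)
  have diff_n': "n' differentiable (at u)" if "u \<in> I" for u
    unfolding n'_def
    using has_vector_derivative_along_axis_curve[OF smooth_on_frechet_derivative[OF \<nu>(1)]] sub that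
    by (blast intro: differentiableI_vector)
  have diff_e': "e' differentiable (at u)" if "u \<in> I" for u
    unfolding e'_def
    using smooth_on_imp_differentiable[OF smooth_on_frechet_derivative[OF e(1)] that] .
  have diff_e: "e differentiable (at u)" and diff_b: "b differentiable (at u)" if "u \<in> I" for u
    using deriv_e[OF that] deriv_b[OF that] by (auto intro: differentiableI_vector)
  note inner_frame = orth_eb orth_nb orth_en e(2) norm_n norm_b
  have coeffs: "(- n' u) \<bullet> e u = \<kappa>\<^sub>\<nu> u" "(- n' u) \<bullet> b u = \<kappa>\<^sub>t u" "e' u \<bullet> b u = \<kappa>\<^sub>g u" if "u \<in> I" for u
    using inner_frame[OF that]
    by (simp_all add: n'_eq[OF that] e'_eq[OF that] inner_diff_left inner_add_left inner_diff_right
        inner_add_right inner_commute norm_eq_1)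
  have diff: "\<kappa>\<^sub>\<nu> differentiable (at u)" "\<kappa>\<^sub>t differentiable (at u)" "\<kappa>\<^sub>g differentiable (at u)"
    if u: "u \<in> I" for u
  proof -
    note inner = differentiable_inner[OF differentiable_minus[OF diff_n'[OF u]] diff_e[OF u]]
      differentiable_inner[OF differentiable_minus[OF diff_n'[OF u]] diff_b[OF u]]
      differentiable_inner[OF diff_e'[OF u] diff_b[OF u]]
    show "\<kappa>\<^sub>\<nu> differentiable (at u)" "\<kappa>\<^sub>t differentiable (at u)" "\<kappa>\<^sub>g differentiable (at u)"
      by (rule differentiable_transform_open[OF inner(1) I(2) u coeffs(1)]
          differentiable_transform_open[OF inner(2) I(2) u coeffs(2)]
          differentiable_transform_open[OF inner(3) I(2) u coeffs(3)]; assumption)+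
  qed

  \<comment> \<open>The singular set is the whole image of \<open>I\<close>, so by injectivity of
    \<open>axis_curve\<close> equality of the sets leaves no parameter out.\<close>
  have contour: "contour_edge U f I w k \<longleftrightarrow> (\<forall>u\<in>I. w u \<bullet> k = 0)" for w k
    unfolding contour_edge_def sing using inj_axis_curve by (fastforce simp: inj_def)

  show ?thesis
  \<comment> \<open>The instantiated pattern splits only the outer conjunction; the inner
    conjunctions begin with an equivalence and stay whole.\<close>
  proof (intro conjI[of "_ \<longrightarrow> _"] impI)
    assume "\<forall>u\<in>I. (\<kappa>\<^sub>t u)\<^sup>2 + (\<kappa>\<^sub>\<nu> u)\<^sup>2 \<noteq> 0"
    then interpret moving_frame I e b n \<kappa>\<^sub>\<nu> \<kappa>\<^sub>t \<kappa>\<^sub>g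
      by unfold_locales
        (use I inner_frame deriv_e deriv_b deriv_n diff in \<open>auto simp: inner_commute\<close>)
    show "(cylinder I (osculating_developable f e b \<kappa>\<^sub>\<nu> \<kappa>\<^sub>t)
          \<longleftrightarrow> (\<forall>u\<in>I. delta_o \<kappa>\<^sub>g \<kappa>\<^sub>\<nu> \<kappa>\<^sub>t u = 0)) \<and>
       ((\<forall>u\<in>I. delta_o \<kappa>\<^sub>g \<kappa>\<^sub>\<nu> \<kappa>\<^sub>t u = 0)
          \<longleftrightarrow> part_of_great_circle I n) \<and>
       (part_of_great_circle I n
          \<longleftrightarrow> (\<exists>k\<in>sphere 0 1. contour_edge U f I n k)) \<and>
       ((\<exists>k\<in>sphere 0 1. contour_edge U f I n k)
          \<longleftrightarrow> osculating_direction e b \<kappa>\<^sub>\<nu> \<kappa>\<^sub>t constant_on I)"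
      unfolding osculating_developable_def contour part_of_great_circle_iff
        direction_constant_iff_orthogonal delta_0_iff_orthogonal cylinder_iff_orthogonal
      by simp
  next
    assume nz: "\<forall>u\<in>I. (\<kappa>\<^sub>g u)\<^sup>2 + (\<kappa>\<^sub>t u)\<^sup>2 \<noteq> 0"
    \<comment> \<open>The sign of \<open>- n u\<close> turns \<open>\<beta> p - \<alpha> q\<close>
      into \<open>\<kappa>\<^sub>t e + \<kappa>\<^sub>g n\<close>, and forces
      \<open>\<gamma> = - \<kappa>\<^sub>\<nu>\<close> in the equation for the derivative of
      \<open>e\<close>.\<close>
    interpret moving_frame I e "\<lambda>u. - n u" b \<kappa>\<^sub>g \<kappa>\<^sub>t "\<lambda>u. - \<kappa>\<^sub>\<nu> u"
    proof unfold_locales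
      fix u assume u: "u \<in> I"
      show "(e has_vector_derivative - \<kappa>\<^sub>\<nu> u *\<^sub>R - n u + \<kappa>\<^sub>g u *\<^sub>R b u) (at u)"
        using deriv_e[OF u] by (simp add: add.commute)
      show "((\<lambda>u. - n u) has_vector_derivative - (- \<kappa>\<^sub>\<nu> u) *\<^sub>R e u + \<kappa>\<^sub>t u *\<^sub>R b u) (at u)"
        using has_vector_derivative_minus[OF deriv_n[OF u]] by (simp add: add.commute)
      show "(b has_vector_derivative - \<kappa>\<^sub>g u *\<^sub>R e u - \<kappa>\<^sub>t u *\<^sub>R - n u) (at u)"
        using deriv_b[OF u] by simp
      show "(\<kappa>\<^sub>t u)\<^sup>2 + (\<kappa>\<^sub>g u)\<^sup>2 \<noteq> 0"
        using nz u by (simp add: add.commute)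
    qed (use I inner_frame diff in \<open>auto simp: inner_commute\<close>)
    have dir: "normal_direction e n \<kappa>\<^sub>g \<kappa>\<^sub>t = D"
      by (simp add: fun_eq_iff normal_direction_def osculating_direction_def)
    \<comment> \<open>The two expressions are negatives of each other, so only their zeros are
      compared.\<close>
    have delta: "delta_n \<kappa>\<^sub>g \<kappa>\<^sub>\<nu> \<kappa>\<^sub>t u = 0 \<longleftrightarrow> \<delta> u = 0" for u
      by (simp add: delta_n_def delta_o_def algebra_simps) argo
    show "(cylinder I (normal_developable f e n \<kappa>\<^sub>g \<kappa>\<^sub>t)
          \<longleftrightarrow> (\<forall>u\<in>I. delta_n \<kappa>\<^sub>g \<kappa>\<^sub>\<nu> \<kappa>\<^sub>t u = 0)) \<and>
       ((\<forall>u\<in>I. delta_n \<kappa>\<^sub>g \<kappa>\<^sub>\<nu> \<kappa>\<^sub>t u = 0)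
          \<longleftrightarrow> part_of_great_circle I b) \<and>
       (part_of_great_circle I b
          \<longleftrightarrow> (\<exists>k\<in>sphere 0 1. contour_edge U f I b k)) \<and>
       ((\<exists>k\<in>sphere 0 1. contour_edge U f I b k)
          \<longleftrightarrow> normal_direction e n \<kappa>\<^sub>g \<kappa>\<^sub>t constant_on I)"
      unfolding normal_developable_def contour part_of_great_circle_iff dir delta
        direction_constant_iff_orthogonal delta_0_iff_orthogonal cylinder_iff_orthogonal
      by simp
  qed
qed

end
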